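(* Let $k\ge 2$ and let $T$ be a simplicial tree which is a $k$-family on $n$ vertices, with $f_{k-1}(T)$ facets and Laplacian eigenvalues $\lambda_1\ge\lambda_2\ge\cdots$. Then for every positive integer $t$, $$\sum_{i=1}^{t}\lambda_i \le (k-1)f_{k-1}(T) + kt - k + 1.$$
   Context: A $k$-family on vertex set $[n]$ is a pure $(k-1)$-dimensional abstract simplicial complex, determined by a nonempty set of $k$-element subsets of $[n]$ (its facets); $f_{k-1}(T)$ is the number of facets. Let $\partial_{k-1}$ be the matrix with rows indexed by the $(k-1)$-element subsets of $[n]$ and columns by the facets, with entry $(-1)^j$ in row $G$, column $F=\{v_0<\cdots<v_{k-1}\}$ if $G=F\setminus\{v_j\}$, and $0$ otherwise. The Laplacian is $L(T)=\partial_{k-1}\partial_{k-1}^T$ with eigenvalues $\lambda_1\ge\lambda_2\ge\cdots\ge0$; set $\lambda_i=0$ beyond the matrix size. The ridge graph of a $k$-family has one vertex per facet, two facets adjacent iff they share $k-1$ elements; the $k$-family is (ridge-)connected if its ridge graph is connected. A $k$-subfamily is a $k$-family whose facets form a nonempty subset of the facets. A facet $F$ of a $k$-family $T$ is a leaf if either $F$ is the only facet of $T$, or there is a facet $G\neq F$ of $T$ such that $F\cap\bigcup_{H\neq F}H\subseteq G$, where the union is over all facets $H\neq F$ of $T$. A simplicial tree is a connected $k$-family every $k$-subfamily of which has a leaf. *)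

theory Defs
  imports
    "Jordan_Normal_Form.Char_Poly"
    "Graph_Theory.Digraph_Component"
begin

text \<open>A \<open>k\<close>-family is represented by its set of facets, which determines it.\<close>

definition k_family :: "nat \<Rightarrow> nat \<Rightarrow> nat set set \<Rightarrow> bool" where
  "k_family k n T \<longleftrightarrow> T \<noteq> {} \<and> (\<forall>F\<in>T. F \<subseteq> {1..n} \<and> card F = k)"

definition k_subfamily :: "nat \<Rightarrow> nat \<Rightarrow> nat set set \<Rightarrow> nat set set \<Rightarrow> bool" where
  "k_subfamily k n S T \<longleftrightarrow> k_family k n S \<and> S \<subseteq> T"

text \<open>Each undirected edge of the ridge graph appears as a pair of opposite arcs.\<close>

definition ridge_graph :: "nat \<Rightarrow> nat set set \<Rightarrow> nat set pair_pre_digraph" where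
  "ridge_graph k T =
     \<lparr>pverts = T, parcs = {(F, G). F \<in> T \<and> G \<in> T \<and> F \<noteq> G \<and> card (F \<inter> G) = k - 1}\<rparr>"

definition ridge_connected :: "nat \<Rightarrow> nat set set \<Rightarrow> bool" where
  "ridge_connected k T \<longleftrightarrow> Digraph_Component.connected (with_proj (ridge_graph k T))"

definition leaf :: "nat set set \<Rightarrow> nat set \<Rightarrow> bool" where
  "leaf T F \<longleftrightarrow> F \<in> T \<and> (T = {F} \<or> (\<exists>G\<in>T. G \<noteq> F \<and> F \<inter> \<Union>(T - {F}) \<subseteq> G))"

definition simplicial_tree :: "nat \<Rightarrow> nat \<Rightarrow> nat set set \<Rightarrow> bool" where
  "simplicial_tree k n T \<longleftrightarrow>
     k_family k n T \<and> ridge_connected k T \<and> (\<forall>S. k_subfamily k n S T \<longrightarrow> (\<exists>F. leaf S F))"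

text \<open>A fixed enumeration of the \<open>k\<close>-element subsets of \<open>{1..n}\<close>. It only serves to number the
  rows and columns of the boundary matrix; the Laplacian spectrum does not depend on it.\<close>

definition subset_list :: "nat \<Rightarrow> nat \<Rightarrow> nat set list" where
  "subset_list n k = filter (\<lambda>S. card S = k) (map set (subseqs [1..<Suc n]))"

lemma distinct_subset_list: "distinct (subset_list n k)"
  unfolding subset_list_def by (intro distinct_filter distinct_set_subseqs distinct_upt)

lemma set_subset_list: "set (subset_list n k) = {S. S \<subseteq> {1..n} \<and> card S = k}"
  using subseqs_powset[of "[1..<Suc n]"]
  by (auto simp: subset_list_def atLeastLessThanSuc_atLeastAtMost simp del: upt_Suc)

text \<open>Here \<open>sorted_list_of_set F ! j\<close> is the vertex \<open>v\<^sub>j\<close> of \<open>F = {v\<^sub>0 < v\<^sub>1 < \<dots>}\<close>.\<close>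

definition boundary_entry :: "nat set \<Rightarrow> nat set \<Rightarrow> real" where
  "boundary_entry G F =
     (if \<exists>j < card F. G = F - {sorted_list_of_set F ! j}
      then (-1) ^ (THE j. j < card F \<and> G = F - {sorted_list_of_set F ! j})
      else 0)"

definition boundary_matrix :: "nat \<Rightarrow> nat \<Rightarrow> nat set set \<Rightarrow> real mat" where
  "boundary_matrix k n T =
     (let rows = subset_list n (k - 1); cols = filter (\<lambda>F. F \<in> T) (subset_list n k)
      in mat (length rows) (length cols) (\<lambda>(i, j). boundary_entry (rows ! i) (cols ! j)))"

definition laplacian :: "nat \<Rightarrow> nat \<Rightarrow> nat set set \<Rightarrow> real mat" where
  "laplacian k n T = boundary_matrix k n T * transpose_mat (boundary_matrix k n T)"

text \<open>The Laplacian is real symmetric, so the real roots of its characteristic polynomial, with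
  multiplicity, are all its eigenvalues.\<close>

definition laplacian_spectrum :: "nat \<Rightarrow> nat \<Rightarrow> nat set set \<Rightarrow> real list" where
  "laplacian_spectrum k n T =
     rev (sorted_list_of_multiset (proots (char_poly (laplacian k n T))))"

text \<open>Indexed from 1: \<open>laplacian_eigenvalue k n T 1\<close> is the largest eigenvalue.\<close>

definition laplacian_eigenvalue :: "nat \<Rightarrow> nat \<Rightarrow> nat set set \<Rightarrow> nat \<Rightarrow> real" where
  "laplacian_eigenvalue k n T i =
     (let ls = laplacian_spectrum k n T
      in if 1 \<le> i \<and> i \<le> length ls then ls ! (i - 1) else 0)"

end

theory Submission
  imports Defs "Jordan_Normal_Form.Schur_Decomposition"
begin

text \<open>The nonzero spectrum of \<open>L(T) = B B\<^sup>T\<close> is that of the Gram matrix \<open>B\<^sup>T B\<close>, which is a sum over the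
  ridges \<open>R\<close> of the rank-one matrices \<open>b\<^sub>R b\<^sub>R\<^sup>T\<close>, where \<open>b\<^sub>R\<close> is the row of \<open>R\<close> in \<open>B\<close>, with \<open>d\<^sub>R\<close> nonzero
  entries \<open>\<plusminus>1\<close>. Every facet has \<open>k\<close> ridges, so the projections \<open>P\<^sub>R\<close> onto the supports of the rows sum
  to \<open>k I\<close>. Since \<open>b\<^sub>R b\<^sub>R\<^sup>T - P\<^sub>R\<close> has \<open>d\<^sub>R - 1\<close> as its only positive eigenvalue, the \<open>t\<close> largest
  eigenvalues of \<open>L(T)\<close> sum to at most \<open>k t + \<Sum>\<^sub>R (d\<^sub>R - 1) = k t + k f - r\<close>, where \<open>r\<close> is the number of
  ridges. Removing leaves one at a time, each of which owns a free vertex and hence a private ridge,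
  gives \<open>r \<ge> f + k - 1\<close>.\<close>

section \<open>Orthonormal eigenvectors of real symmetric matrices\<close>

text \<open>Gram-Schmidt keeps the first vector of a basis extending \<open>v\<close>, so
  normalising its output gives an orthogonal matrix whose first column points along
  \<open>v\<close>. Over the reals conjugation is trivial, hence \<open>corthogonal\<close> is
  ordinary orthogonality.\<close>

lemma orthogonal_mat_with_first_col:
  fixes v :: "real vec"
  assumes v: "v \<in> carrier_vec n" and v0: "v \<noteq> 0\<^sub>v n"
  obtains W c where "W \<in> carrier_mat n n" "transpose_mat W * W = 1\<^sub>m n" "col W 0 = c \<cdot>\<^sub>v v"
proof -
  have conj: "conjugate x = x" for x :: "real vec"
    by (rule eq_vecI) auto
  have n: "n \<noteq> 0" using v v0 by auto
  interpret cof_vec_space n "TYPE(real)" .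
  note b = basis_completion[OF v v0]
  define us where "us = gram_schmidt n (basis_completion v)"
  have us: "set us \<subseteq> carrier_vec n" "corthogonal us" "length us = n"
    using gram_schmidt_result[OF b(2,4,5) us_def] b(6) by auto
  obtain vs where vs: "basis_completion v = v # vs"
    using b(6,7) n by (cases "basis_completion v") auto
  have hd: "us ! 0 = v"
    using gram_schmidt_hd[OF v, of vs] us(3) n
    by (simp add: us_def vs hd_conv_nth[symmetric] flip: length_greater_0_conv)
  have uc: "us ! i \<in> carrier_vec n" if "i < n" for i
    using us that by (auto simp: subset_eq)
  have orth: "us ! i \<bullet> us ! j = 0 \<longleftrightarrow> i \<noteq> j" if "i < n" "j < n" for i j
    using corthogonalD[OF us(2), of i j] that us(3) by (simp add: conj)
  define d where "d i = 1 / sqrt (us ! i \<bullet> us ! i)" for i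
  define W where "W = mat_of_cols n (map (\<lambda>i. d i \<cdot>\<^sub>v us ! i) [0..<n])"
  have W: "W \<in> carrier_mat n n" by (simp add: W_def mat_of_cols_def)
  have col: "col W i = d i \<cdot>\<^sub>v us ! i" if "i < n" for i
    unfolding W_def using that uc[OF that] by (subst col_mat_of_cols) auto
  have pos: "us ! i \<bullet> us ! i > 0" if "i < n" for i
  proof -
    have "us ! i \<bullet> us ! i \<ge> 0" by (auto simp: scalar_prod_def intro: sum_nonneg)
    with orth[OF that that] show ?thesis by linarith
  qed
  have "transpose_mat W * W = 1\<^sub>m n"
  proof (rule eq_matI)
    fix i j assume "i < dim_row (1\<^sub>m n :: real mat)" "j < dim_col (1\<^sub>m n :: real mat)"
    then have ij: "i < n" "j < n" by auto
    have "(transpose_mat W * W) $$ (i, j) = d i * (d j * (us ! i \<bullet> us ! j))"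
      using ij W uc[OF ij(1)] uc[OF ij(2)] by (simp add: col)
    also have "\<dots> = (if i = j then 1 else 0)"
      using ij orth[OF ij] pos[of i] by (auto simp: d_def)
    finally show "(transpose_mat W * W) $$ (i, j) = 1\<^sub>m n $$ (i, j)" using ij by simp
  qed (use W in auto)
  with W col[of 0] hd n that show ?thesis by simp
qed

text \<open>In an orthonormal basis that starts with an eigenvector, the first column of the matrix
  is \<open>e\<close> times a unit vector. Symmetry then clears the first row as well, which leaves
  a smaller symmetric block \<open>A'\<close> and splits off one linear factor.\<close>

lemma symmetric_deflation:
  fixes A :: "real mat"
  assumes A: "A \<in> carrier_mat n n" and sym: "transpose_mat A = A"
    and ev: "eigenvalue A e"
  obtains m W A' where "n = Suc m" "W \<in> carrier_mat n n" "transpose_mat W * W = 1\<^sub>m n"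
    "A' \<in> carrier_mat m m" "transpose_mat A' = A'"
    "A * W = W * four_block_mat (mat 1 1 (\<lambda>_. e)) (0\<^sub>m 1 m) (0\<^sub>m m 1) A'"
    "char_poly A = [:-e, 1:] * char_poly A'"
proof -
  obtain v where v: "v \<in> carrier_vec n" and v0: "v \<noteq> 0\<^sub>v n" and Av: "A *\<^sub>v v = e \<cdot>\<^sub>v v"
    using ev A by (auto simp: eigenvalue_def eigenvector_def)
  obtain m where n: "n = Suc m" using v v0 by (cases n) auto
  obtain W c where W: "W \<in> carrier_mat n n" and WtW: "transpose_mat W * W = 1\<^sub>m n"
    and col0: "col W 0 = c \<cdot>\<^sub>v v"
    using orthogonal_mat_with_first_col[OF v v0] .
  have Wt: "transpose_mat W \<in> carrier_mat n n" using W by simp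
  have WWt: "W * transpose_mat W = 1\<^sub>m n"
    using mat_mult_left_right_inverse[OF Wt W WtW] .
  define M where "M = transpose_mat W * (A * W)"
  have M: "M \<in> carrier_mat n n" using W A by (simp add: M_def)
  have WM: "A * W = W * M"
    unfolding M_def using W A WWt by (subst assoc_mult_mat[symmetric, of _ n n _ n _ n]) auto
  have Msym: "transpose_mat M = M"
    unfolding M_def using W A sym
    by (subst transpose_mult[of _ n n _ n], simp, simp)
       (subst transpose_mult[of _ n n _ n], auto simp: assoc_mult_mat[of _ n n _ n _ n])
  \<comment> \<open>Column 0 of \<open>W\<close> is a multiple of \<open>v\<close>, so it inherits
    the eigenvector equation.\<close>
  have AW0: "A *\<^sub>v col W 0 = e \<cdot>\<^sub>v col W 0"
    using A v Av by (simp add: col0 mult_mat_vec smult_smult_assoc mult.commute)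
  have M0: "M $$ (i, 0) = (if i = 0 then e else 0)" if "i < n" for i
  proof -
    have "M $$ (i, 0) = col W i \<bullet> (A *\<^sub>v col W 0)"
      using that n W A by (simp add: M_def mult_mat_vec_def)
    also have "\<dots> = e * (transpose_mat W * W) $$ (i, 0)"
      using that n W by (simp add: AW0)
    finally show ?thesis using that n by (simp add: WtW)
  qed
  have M0': "M $$ (0, i) = (if i = 0 then e else 0)" if "i < n" for i
    using M0[OF that] that M n by (subst Msym[symmetric]) simp
  define A' where "A' = mat m m (\<lambda>(i, j). M $$ (Suc i, Suc j))"
  have A': "A' \<in> carrier_mat m m" by (simp add: A'_def)
  have Mblock: "M = four_block_mat (mat 1 1 (\<lambda>_. e)) (0\<^sub>m 1 m) (0\<^sub>m m 1) A'"
    by (rule eq_matI) (use M n M0 M0' in \<open>auto simp: A'_def\<close>)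
  have A'sym: "transpose_mat A' = A'"
  proof (rule eq_matI)
    fix i j assume "i < dim_row A'" "j < dim_col A'"
    then show "transpose_mat A' $$ (i, j) = A' $$ (i, j)"
      using M n arg_cong[OF Msym, of "\<lambda>X. X $$ (Suc i, Suc j)"] by (simp add: A'_def)
  qed (simp_all add: A'_def)
  have "similar_mat M A"
    unfolding similar_mat_def
    by (rule exI[of _ "transpose_mat W"], rule exI[of _ W], rule similar_mat_witI[of _ _ n])
       (use M A W WtW WWt in \<open>auto simp: M_def assoc_mult_mat[of _ n n _ n _ n]\<close>)
  then have "char_poly A = char_poly M" by (simp add: char_poly_similar)
  also have "\<dots> = char_poly (mat 1 1 (\<lambda>_. e)) * char_poly A'"
    unfolding Mblock by (rule char_poly_four_block_zeros_col) (use A' in auto)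
  also have "char_poly (mat 1 1 (\<lambda>_. e)) = [:-e, 1:]"
    by (simp add: char_poly_defs det_def sign_def)
  finally have cp: "char_poly A = [:-e, 1:] * char_poly A'" .
  show ?thesis using that[OF n W WtW A' A'sym _ cp] WM Mblock by simp
qed

text \<open>Induction on \<open>es\<close>, deflating by its head each time. The list may be in any
  order, so the eigenvectors can later be indexed by the decreasing spectrum.\<close>

lemma symmetric_orthonormal_eigenvectors:
  fixes A :: "real mat"
  assumes "A \<in> carrier_mat n n" "transpose_mat A = A" "mset es = proots (char_poly A)"
  obtains v where "\<And>i. i < length es \<Longrightarrow> v i \<in> carrier_vec n"
    "\<And>i. i < length es \<Longrightarrow> A *\<^sub>v v i = es ! i \<cdot>\<^sub>v v i"
    "\<And>i j. i < length es \<Longrightarrow> j < length es \<Longrightarrow> v i \<bullet> v j = (if i = j then 1 else 0)"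
proof -
  have "\<exists>v. (\<forall>i < length es. v i \<in> carrier_vec n \<and> A *\<^sub>v v i = es ! i \<cdot>\<^sub>v v i) \<and>
    (\<forall>i < length es. \<forall>j < length es. v i \<bullet> v j = (if i = j then 1 else 0))"
    using assms
  proof (induction es arbitrary: n A)
    case Nil
    then show ?case by simp
  next
    case (Cons e es)
    note A = Cons.prems(1)
    have cp0: "char_poly A \<noteq> 0" using degree_monic_char_poly[OF A] by auto
    have "e \<in># proots (char_poly A)" by (simp flip: Cons.prems(3))
    then have "eigenvalue A e"
      using cp0 by (simp add: eigenvalue_root_char_poly[OF A])
    from symmetric_deflation[OF A Cons.prems(2) this]
    obtain m W A' where n: "n = Suc m" and W: "W \<in> carrier_mat n n"
      and WtW: "transpose_mat W * W = 1\<^sub>m n"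
      and A': "A' \<in> carrier_mat m m" "transpose_mat A' = A'"
      and AW: "A * W = W * four_block_mat (mat 1 1 (\<lambda>_. e)) (0\<^sub>m 1 m) (0\<^sub>m m 1) A'"
      and cp: "char_poly A = [:-e, 1:] * char_poly A'" .
    let ?M = "four_block_mat (mat 1 1 (\<lambda>_. e)) (0\<^sub>m 1 m) (0\<^sub>m m 1) A'"
    have M: "?M \<in> carrier_mat n n" using A' n by auto
    have "proots (char_poly A) = {#e#} + proots (char_poly A')"
      using cp0 unfolding cp by (subst proots_mult) auto
    then have "mset es = proots (char_poly A')"
      using Cons.prems(3) by simp
    from Cons.IH[OF A' this] obtain u where
      u: "\<And>i. i < length es \<Longrightarrow> u i \<in> carrier_vec m"
        "\<And>i. i < length es \<Longrightarrow> A' *\<^sub>v u i = es ! i \<cdot>\<^sub>v u i"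
        "\<And>i j. i < length es \<Longrightarrow> j < length es \<Longrightarrow> u i \<bullet> u j = (if i = j then 1 else 0)"
      by blast
    \<comment> \<open>Eigenvectors of the block matrix: the first unit vector for \<open>e\<close>,
      and the eigenvectors of \<open>A'\<close> padded with a leading zero.\<close>
    define x where "x i = (case i of 0 \<Rightarrow> vec 1 (\<lambda>_. 1) @\<^sub>v 0\<^sub>v m | Suc j \<Rightarrow> 0\<^sub>v 1 @\<^sub>v u j)" for i
    have x: "x i \<in> carrier_vec n" if "i < length (e # es)" for i
      by (rule carrier_vecI, cases i) (use that u(1) n in \<open>auto simp: x_def dest: carrier_vecD\<close>)
    have Mx: "?M *\<^sub>v x i = (e # es) ! i \<cdot>\<^sub>v x i" if "i < length (e # es)" for i
    proof (cases i)
      case 0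
      show ?thesis
        unfolding 0 x_def using A'
        by (intro eq_vecI) (auto simp: four_block_mat_mult_vec[of _ 1 1 _ m _ m] scalar_prod_def)
    next
      case (Suc j)
      with that have j: "j < length es" by simp
      show ?thesis
        unfolding Suc x_def using A' u(1,2)[OF j]
        by (intro eq_vecI)
           (auto simp: four_block_mat_mult_vec[of _ 1 1 _ m _ m] scalar_prod_def[of "row _ _"])
    qed
    have xx: "x i \<bullet> x j = (if i = j then 1 else 0)"
      if "i < length (e # es)" "j < length (e # es)" for i j
      using that u(1,3)
      by (cases i; cases j) (auto simp: x_def scalar_prod_append[of _ 1 _ m] scalar_prod_def[of "vec _ _"])
    \<comment> \<open>Multiplication by \<open>W\<close> carries eigenvectors of the block matrix to
      eigenvectors of \<open>A\<close> and, being orthogonal, preserves inner products.\<close>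
    have "A *\<^sub>v (W *\<^sub>v x i) = (e # es) ! i \<cdot>\<^sub>v (W *\<^sub>v x i)" if "i < length (e # es)" for i
    proof -
      have "A *\<^sub>v (W *\<^sub>v x i) = (A * W) *\<^sub>v x i" using A W x[OF that] by simp
      also have "\<dots> = W *\<^sub>v (?M *\<^sub>v x i)" unfolding AW using W M x[OF that] by simp
      finally show ?thesis unfolding Mx[OF that] using W x[OF that] by (simp add: mult_mat_vec)
    qed
    moreover have "(W *\<^sub>v x i) \<bullet> (W *\<^sub>v x j) = x i \<bullet> x j"
      if "i < length (e # es)" "j < length (e # es)" for i j
    proof -
      have "(W *\<^sub>v x i) \<bullet> (W *\<^sub>v x j) = (transpose_mat W *\<^sub>v (W *\<^sub>v x i)) \<bullet> x j"
        using W x that by (subst transpose_vec_mult_scalar[of W n n]) auto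
      also have "transpose_mat W *\<^sub>v (W *\<^sub>v x i) = (transpose_mat W * W) *\<^sub>v x i"
        using W x that by (subst assoc_mult_mat_vec[of _ n n _ n]) auto
      finally show ?thesis using x that by (simp add: WtW)
    qed
    ultimately show ?case
      using W x xx by (intro exI[of _ "\<lambda>i. W *\<^sub>v x i"]) auto
  qed
  then show ?thesis using that by blast
qed

section \<open>Trace bounds for matrices with entries in {-1, 0, 1}\<close>

text \<open>Expand the squared length of the residual of \<open>b\<close> after projection onto the
  span of the \<open>x i\<close>.\<close>

lemma Bessel_inequality:
  fixes b :: "'c \<Rightarrow> real" and x :: "'i \<Rightarrow> 'c \<Rightarrow> real"
  assumes I: "finite I"
    and orth: "\<And>i j. i \<in> I \<Longrightarrow> j \<in> I \<Longrightarrow> (\<Sum>c\<in>C. x i c * x j c) = (if i = j then 1 else 0)"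
  shows "(\<Sum>i\<in>I. (\<Sum>c\<in>C. b c * x i c)\<^sup>2) \<le> (\<Sum>c\<in>C. (b c)\<^sup>2)"
proof -
  define a where "a i = (\<Sum>c\<in>C. b c * x i c)" for i
  have 1: "(\<Sum>c\<in>C. b c * (\<Sum>i\<in>I. a i * x i c)) = (\<Sum>i\<in>I. (a i)\<^sup>2)"
    unfolding sum_distrib_left
    by (subst sum.swap) (simp add: a_def power2_eq_square sum_distrib_left mult_ac)
  have "(\<Sum>c\<in>C. (\<Sum>i\<in>I. a i * x i c)\<^sup>2) = (\<Sum>c\<in>C. \<Sum>i\<in>I. \<Sum>j\<in>I. a i * a j * (x i c * x j c))"
    by (simp add: power2_eq_square sum_product mult_ac)
  also have "\<dots> = (\<Sum>i\<in>I. \<Sum>j\<in>I. a i * a j * (\<Sum>c\<in>C. x i c * x j c))"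
    by (subst sum.swap, intro sum.cong refl, subst sum.swap) (simp add: sum_distrib_left)
  also have "\<dots> = (\<Sum>i\<in>I. \<Sum>j\<in>I. if i = j then (a i)\<^sup>2 else 0)"
    by (intro sum.cong refl) (auto simp: orth power2_eq_square)
  also have "\<dots> = (\<Sum>i\<in>I. (a i)\<^sup>2)" using I by simp
  finally have 2: "(\<Sum>c\<in>C. (\<Sum>i\<in>I. a i * x i c)\<^sup>2) = (\<Sum>i\<in>I. (a i)\<^sup>2)" .
  have "0 \<le> (\<Sum>c\<in>C. (b c - (\<Sum>i\<in>I. a i * x i c))\<^sup>2)" by (simp add: sum_nonneg)
  also have "\<dots> = (\<Sum>c\<in>C. (b c)\<^sup>2) - 2 * (\<Sum>c\<in>C. b c * (\<Sum>i\<in>I. a i * x i c))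
      + (\<Sum>c\<in>C. (\<Sum>i\<in>I. a i * x i c)\<^sup>2)"
    by (simp add: power2_diff sum.distrib sum_subtractf sum_distrib_left mult_ac)
  finally show ?thesis by (simp add: 1 2 flip: a_def)
qed

text \<open>One row's share of the trace bound: on an orthonormal family, the form of b b^T exceeds
  that of the projection onto the support of \<open>b\<close> by at most d - 1. Cauchy-Schwarz gives
  \<open>S \<le> d * Q\<close>, Bessel gives \<open>S \<le> d\<close>, and weighting the latter by d
  - 1 combines the two.\<close>

lemma sign_row_excess:
  fixes b :: "'c \<Rightarrow> real" and x :: "'i \<Rightarrow> 'c \<Rightarrow> real"
  assumes I: "finite I"
    and orth: "\<And>i j. i \<in> I \<Longrightarrow> j \<in> I \<Longrightarrow> (\<Sum>c\<in>C. x i c * x j c) = (if i = j then 1 else 0)"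
    and b: "\<And>c. c \<in> C \<Longrightarrow> b c \<in> {-1, 0, 1}" and ne: "\<exists>c\<in>C. b c \<noteq> 0" and C: "finite C"
  shows "(\<Sum>i\<in>I. (\<Sum>c\<in>C. b c * x i c)\<^sup>2)
    \<le> (\<Sum>i\<in>I. \<Sum>c\<in>C. (b c)\<^sup>2 * (x i c)\<^sup>2) + ((\<Sum>c\<in>C. (b c)\<^sup>2) - 1)"
proof -
  define d where "d = (\<Sum>c\<in>C. (b c)\<^sup>2)"
  have d1: "d \<ge> 1"
  proof -
    obtain c where c: "c \<in> C" "b c \<noteq> 0" using ne by blast
    with b[of c] have "1 = (b c)\<^sup>2" by auto
    also have "\<dots> \<le> d" unfolding d_def using c C by (intro member_le_sum) auto
    finally show ?thesis .
  qed
  define S where "S = (\<Sum>i\<in>I. (\<Sum>c\<in>C. b c * x i c)\<^sup>2)"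
  define Q where "Q = (\<Sum>i\<in>I. \<Sum>c\<in>C. (b c)\<^sup>2 * (x i c)\<^sup>2)"
  have cs: "(\<Sum>c\<in>C. b c * x i c)\<^sup>2 \<le> d * (\<Sum>c\<in>C. (b c)\<^sup>2 * (x i c)\<^sup>2)" for i
  proof -
    define s where "s = (\<Sum>c\<in>C. b c * x i c)"
    \<comment> \<open>Cauchy-Schwarz on the support of \<open>b\<close>, proved by completing the
      square. The entries satisfy b^3 = b and b^4 = b^2, which simplifies the last two
      terms.\<close>
    have term_eq: "(b c * x i c - s / d * (b c)\<^sup>2)\<^sup>2
      = (b c)\<^sup>2 * (x i c)\<^sup>2 - 2 * (s / d) * (b c * x i c) + (s / d)\<^sup>2 * (b c)\<^sup>2"
      if "c \<in> C" for c
      using b[OF that] by (auto simp: power2_eq_square algebra_simps)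
    have "0 \<le> (\<Sum>c\<in>C. (b c * x i c - s / d * (b c)\<^sup>2)\<^sup>2)" by (simp add: sum_nonneg)
    also have "\<dots> = (\<Sum>c\<in>C. (b c)\<^sup>2 * (x i c)\<^sup>2 - 2 * (s / d) * (b c * x i c)
        + (s / d)\<^sup>2 * (b c)\<^sup>2)"
      by (rule sum.cong[OF refl term_eq])
    also have "\<dots> = (\<Sum>c\<in>C. (b c)\<^sup>2 * (x i c)\<^sup>2) - 2 * (s / d) * s + (s / d)\<^sup>2 * d"
      by (simp only: sum.distrib sum_subtractf s_def[symmetric] d_def[symmetric]
          flip: sum_distrib_left)
    also have "\<dots> = (\<Sum>c\<in>C. (b c)\<^sup>2 * (x i c)\<^sup>2) - s\<^sup>2 / d"
      using d1 by (simp add: power2_eq_square field_simps)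
    finally show ?thesis using d1 by (simp add: s_def field_simps)
  qed
  have SQ: "S \<le> d * Q"
    unfolding S_def Q_def sum_distrib_left[of d "\<lambda>i. \<Sum>c\<in>C. (b c)\<^sup>2 * (x i c)\<^sup>2"]
    by (intro sum_mono cs)
  have Sd: "S \<le> d"
    unfolding S_def d_def by (rule Bessel_inequality[OF I orth])
  have "d * S = (d - 1) * S + S" by (simp add: algebra_simps)
  also have "\<dots> \<le> (d - 1) * d + d * Q"
    using SQ Sd d1 by (intro add_mono mult_left_mono) auto
  also have "\<dots> = d * (Q + (d - 1))" by (simp add: algebra_simps)
  finally show ?thesis using d1 unfolding S_def Q_def d_def by simp
qed

text \<open>Sum the row estimate over all rows. As every column has squared norm \<open>k\<close>,
  the projections sum to \<open>k\<close> times the identity and contribute \<open>k\<close> per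
  unit vector; the excesses add up to the total squared norm minus the number of nonzero
  rows.\<close>

lemma sign_matrix_trace_bound:
  fixes b :: "'r \<Rightarrow> 'c \<Rightarrow> real" and x :: "'i \<Rightarrow> 'c \<Rightarrow> real"
  assumes fin: "finite I" "finite R" "finite C"
    and orth: "\<And>i j. i \<in> I \<Longrightarrow> j \<in> I \<Longrightarrow> (\<Sum>c\<in>C. x i c * x j c) = (if i = j then 1 else 0)"
    and b: "\<And>r c. r \<in> R \<Longrightarrow> c \<in> C \<Longrightarrow> b r c \<in> {-1, 0, 1}"
    and col: "\<And>c. c \<in> C \<Longrightarrow> (\<Sum>r\<in>R. (b r c)\<^sup>2) = k"
  shows "(\<Sum>i\<in>I. \<Sum>r\<in>R. (\<Sum>c\<in>C. b r c * x i c)\<^sup>2)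
    \<le> k * real (card I) + (k * real (card C) - real (card {r\<in>R. \<exists>c\<in>C. b r c \<noteq> 0}))"
proof -
  let ?P = "\<lambda>r. \<exists>c\<in>C. b r c \<noteq> 0"
  \<comment> \<open>A zero row contributes nothing, so 1 may be subtracted only for nonzero rows;
    \<open>of_bool\<close> records this.\<close>
  have row: "(\<Sum>i\<in>I. (\<Sum>c\<in>C. b r c * x i c)\<^sup>2)
    \<le> (\<Sum>i\<in>I. \<Sum>c\<in>C. (b r c)\<^sup>2 * (x i c)\<^sup>2) + ((\<Sum>c\<in>C. (b r c)\<^sup>2) - of_bool (?P r))"
    if "r \<in> R" for r
  proof (cases "?P r")
    case True
    then show ?thesis using sign_row_excess[OF fin(1) orth b[OF that] True fin(3)] by simp
  next
    case False
    then show ?thesis by simp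
  qed
  have 1: "(\<Sum>r\<in>R. \<Sum>i\<in>I. \<Sum>c\<in>C. (b r c)\<^sup>2 * (x i c)\<^sup>2) = k * real (card I)"
  proof -
    have "(\<Sum>r\<in>R. \<Sum>i\<in>I. \<Sum>c\<in>C. (b r c)\<^sup>2 * (x i c)\<^sup>2)
        = (\<Sum>i\<in>I. \<Sum>c\<in>C. (\<Sum>r\<in>R. (b r c)\<^sup>2) * (x i c)\<^sup>2)"
      by (subst sum.swap, intro sum.cong refl, subst sum.swap) (simp add: sum_distrib_right)
    also have "\<dots> = (\<Sum>i\<in>I. k * (\<Sum>c\<in>C. x i c * x i c))"
      by (simp add: col sum_distrib_left flip: power2_eq_square)
    finally show ?thesis by (simp add: orth)
  qed
  have 2: "(\<Sum>r\<in>R. \<Sum>c\<in>C. (b r c)\<^sup>2) = k * real (card C)"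
    by (subst sum.swap) (simp add: col)
  have 3: "(\<Sum>r\<in>R. of_bool (?P r)) = real (card {r\<in>R. ?P r})"
    using fin(2) by (simp add: of_bool_def sum.If_cases Int_def)
  have "(\<Sum>i\<in>I. \<Sum>r\<in>R. (\<Sum>c\<in>C. b r c * x i c)\<^sup>2) = (\<Sum>r\<in>R. \<Sum>i\<in>I. (\<Sum>c\<in>C. b r c * x i c)\<^sup>2)"
    by (rule sum.swap)
  also have "\<dots> \<le> (\<Sum>r\<in>R. (\<Sum>i\<in>I. \<Sum>c\<in>C. (b r c)\<^sup>2 * (x i c)\<^sup>2)
      + ((\<Sum>c\<in>C. (b r c)\<^sup>2) - of_bool (?P r)))"
    by (intro sum_mono row)
  finally show ?thesis by (simp only: sum.distrib sum_subtractf 1 2 3)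
qed

section \<open>Counting ridges by removing leaves\<close>

definition ridges :: "nat set set \<Rightarrow> nat set set" where
  "ridges T = (\<Union>F\<in>T. (\<lambda>v. F - {v}) ` F)"

lemma card_ridges_of_facet: "card ((\<lambda>v. F - {v}) ` F) = card F"
  by (intro card_image inj_onI) blast

text \<open>If all vertices of \<open>F\<close> lay in other facets, the leaf condition would put
  \<open>F\<close> inside some \<open>G\<close> of the same size, forcing
  \<open>F = G\<close>.\<close>

lemma leaf_has_free_vertex:
  assumes fam: "\<forall>F\<in>T. finite F \<and> card F = k" and lf: "leaf T F" and ne: "T \<noteq> {F}"
  obtains v where "v \<in> F" "\<And>H. H \<in> T - {F} \<Longrightarrow> v \<notin> H"
proof -
  from lf ne obtain G where G: "F \<in> T" "G \<in> T" "G \<noteq> F" "F \<inter> \<Union>(T - {F}) \<subseteq> G"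
    by (auto simp: leaf_def)
  have "\<not> F \<subseteq> G" using fam G card_subset_eq[of G F] by auto
  then show ?thesis using G that by blast
qed

text \<open>A single facet has \<open>k\<close> ridges, and putting back a removed leaf adds at
  least one new ridge. The leaf hypothesis ranges over all nonempty subsets of \<open>S\<close>, so
  it survives the removal.\<close>

lemma card_ridges_ge:
  assumes "finite S" "S \<noteq> {}" "k \<ge> 2" "\<forall>F\<in>S. finite F \<and> card F = k"
    and "\<forall>S'. S' \<noteq> {} \<and> S' \<subseteq> S \<longrightarrow> (\<exists>F. leaf S' F)"
  shows "card S + k - 1 \<le> card (ridges S)"
  using assms
proof (induction "card S" arbitrary: S rule: less_induct)
  case (less S)
  from less.prems obtain F where F: "leaf S F" by blast
  then have FS: "F \<in> S" by (simp add: leaf_def)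
  show ?case
  proof (cases "S = {F}")
    case True
    with less.prems show ?thesis by (simp add: ridges_def card_ridges_of_facet)
  next
    case False
    obtain v where v: "v \<in> F" "\<And>H. H \<in> S - {F} \<Longrightarrow> v \<notin> H"
      using leaf_has_free_vertex[OF less.prems(4) F False] by blast
    let ?S = "S - {F}"
    have cS: "card S = Suc (card ?S)" by (rule card.remove[OF less.prems(1) FS])
    have IH: "card ?S + k - 1 \<le> card (ridges ?S)"
      using less.prems False FS cS by (intro less.hyps) auto
    \<comment> \<open>Since \<open>k \<ge> 2\<close> there is a second vertex \<open>w\<close>. The
      ridge \<open>F - {w}\<close> still contains the free vertex \<open>v\<close>, so no other
      facet has it.\<close>
    have "\<not> F \<subseteq> {v}"
      using less.prems(3,4) FS card_mono[of "{v}" F] by auto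
    then obtain w where w: "w \<in> F" "w \<noteq> v" by blast
    have "F - {w} \<in> ridges S" using FS w by (auto simp: ridges_def)
    moreover have "F - {w} \<notin> ridges ?S" 
    proof
      assume "F - {w} \<in> ridges ?S"
      then obtain H where "H \<in> ?S" "F - {w} \<subseteq> H" by (auto simp: ridges_def)
      then show False using v w by blast
    qed
    moreover have "ridges ?S \<subseteq> ridges S" by (auto simp: ridges_def)
    moreover have "finite (ridges S)" using less.prems by (auto simp: ridges_def)
    ultimately have "card (ridges ?S) < card (ridges S)"
      by (intro psubset_card_mono) auto
    with IH cS less.prems(3) show ?thesis by linarith
  qed
qed

section \<open>Signs and supports in the boundary matrix\<close>

lemma boundary_entry_range: "boundary_entry G F \<in> {-1, 0, 1}"
  using minus_one_power_iff[where 'a = real] by (auto simp: boundary_entry_def)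

lemma boundary_entry_nonzero_iff:
  assumes "finite F"
  shows "boundary_entry G F \<noteq> 0 \<longleftrightarrow> G \<in> (\<lambda>v. F - {v}) ` F"
proof -
  have "(\<exists>j < card F. G = F - {sorted_list_of_set F ! j}) \<longleftrightarrow> (\<exists>v\<in>F. G = F - {v})"
    using assms by (metis in_set_conv_nth length_sorted_list_of_set set_sorted_list_of_set)
  then show ?thesis by (auto simp: boundary_entry_def)
qed

lemma boundary_entry_sq:
  assumes "finite F"
  shows "(boundary_entry G F)\<^sup>2 = of_bool (G \<in> (\<lambda>v. F - {v}) ` F)"
  unfolding boundary_entry_nonzero_iff[OF assms, symmetric]
  using boundary_entry_range[of G F] by auto

section \<open>From eigenvalues to the trace bound\<close>

text \<open>For a positive eigenvalue, B^T sends the unit eigenvector to a vector whose squared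
  length is that eigenvalue. After normalisation these vectors are orthonormal and \<open>B\<close>
  stretches their squared lengths by the eigenvalues, so \<open>sign_matrix_trace_bound\<close>
  applies.\<close>

lemma sum_gram_eigenvalues_le:
  fixes B :: "real mat"
  assumes B: "B \<in> carrier_mat m f"
    and es: "mset es = proots (char_poly (B * transpose_mat B))"
    and entries: "\<And>r c. r < m \<Longrightarrow> c < f \<Longrightarrow> B $$ (r, c) \<in> {-1, 0, 1}"
    and cols: "\<And>c. c < f \<Longrightarrow> (\<Sum>r<m. (B $$ (r, c))\<^sup>2) = k"
    and k: "k \<ge> 0" and s: "s \<le> length es"
  shows "(\<Sum>i<s. es ! i)
    \<le> k * real s + (k * real f - real (card {r\<in>{..<m}. \<exists>c\<in>{..<f}. B $$ (r, c) \<noteq> 0}))"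
proof -
  let ?A = "B * transpose_mat B"
  have A: "?A \<in> carrier_mat m m" "transpose_mat ?A = ?A"
    using B by (auto simp: transpose_mult[of _ m f _ m])
  obtain v where v: "\<And>i. i < length es \<Longrightarrow> v i \<in> carrier_vec m"
    and Av: "\<And>i. i < length es \<Longrightarrow> ?A *\<^sub>v v i = es ! i \<cdot>\<^sub>v v i"
    and vv: "\<And>i j. i < length es \<Longrightarrow> j < length es \<Longrightarrow> v i \<bullet> v j = (if i = j then 1 else 0)"
    using symmetric_orthonormal_eigenvectors[OF A es] by blast
  define w where "w i = transpose_mat B *\<^sub>v v i" for i
  have w: "w i \<in> carrier_vec f" if "i < length es" for i
    using B v[OF that] by (simp add: w_def)
  have Bw: "B *\<^sub>v w i = es ! i \<cdot>\<^sub>v v i" if "i < length es" for i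
    using Av[OF that] B v[OF that] by (simp add: w_def)
  have ww: "w i \<bullet> w j = (if i = j then es ! i else 0)" if "i < length es" "j < length es" for i j
  proof -
    have "w i \<bullet> w j = v i \<bullet> (B *\<^sub>v w j)"
      using transpose_vec_mult_scalar[OF B w[OF that(2)] v[OF that(1)]] by (simp add: w_def)
    also have "\<dots> = es ! j * (v i \<bullet> v j)"
      using v[OF that(1)] v[OF that(2)] that by (simp add: Bw)
    finally show ?thesis using that by (simp add: vv)
  qed
  \<comment> \<open>Dropping nonpositive eigenvalues does not decrease the sum, and it makes the
    division by \<open>sqrt (es ! i)\<close> legitimate.\<close>
  define I where "I = {i. i < s \<and> es ! i > 0}"
  have I: "finite I" "\<And>i. i \<in> I \<Longrightarrow> i < length es" "\<And>i. i \<in> I \<Longrightarrow> es ! i > 0"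
    using s by (auto simp: I_def)
  define x where "x i c = w i $ c / sqrt (es ! i)" for i c
  have orth: "(\<Sum>c<f. x i c * x j c) = (if i = j then 1 else 0)" if "i \<in> I" "j \<in> I" for i j
  proof -
    have "(\<Sum>c<f. x i c * x j c) = w i \<bullet> w j / (sqrt (es ! i) * sqrt (es ! j))"
      using w[OF I(2)[OF that(2)]]
      by (simp add: x_def scalar_prod_def sum_divide_distrib lessThan_atLeast0)
    then show ?thesis using ww[OF I(2)[OF that(1)] I(2)[OF that(2)]] I(3)[OF that(1)]
      by (auto simp: real_sqrt_mult_self)
  qed
  have energy: "(\<Sum>r<m. (\<Sum>c<f. B $$ (r, c) * x i c)\<^sup>2) = es ! i" if "i \<in> I" for i
  proof -
    note i = I(2)[OF that] I(3)[OF that]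
    have "(\<Sum>c<f. B $$ (r, c) * x i c) = sqrt (es ! i) * v i $ r" if r: "r < m" for r
    proof -
      have "(\<Sum>c<f. B $$ (r, c) * x i c) = (B *\<^sub>v w i) $ r / sqrt (es ! i)"
        using r B w[OF i(1)]
        by (simp add: x_def scalar_prod_def sum_divide_distrib lessThan_atLeast0)
      also have "\<dots> = es ! i / sqrt (es ! i) * v i $ r"
        using r v[OF i(1)] by (simp add: Bw[OF i(1)])
      finally show ?thesis using i(2) by (simp add: real_div_sqrt)
    qed
    then have "(\<Sum>r<m. (\<Sum>c<f. B $$ (r, c) * x i c)\<^sup>2) = (\<Sum>r<m. es ! i * (v i $ r * v i $ r))"
      using i(2) by (intro sum.cong refl) (simp add: power_mult_distrib power2_eq_square)
    also have "\<dots> = es ! i * (v i \<bullet> v i)"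
      using v[OF i(1)] by (simp add: scalar_prod_def sum_distrib_left lessThan_atLeast0)
    finally show ?thesis using vv[OF i(1) i(1)] by simp
  qed
  let ?N = "{r\<in>{..<m}. \<exists>c\<in>{..<f}. B $$ (r, c) \<noteq> 0}"
  have "(\<Sum>i<s. es ! i) \<le> (\<Sum>i<s. if es ! i > 0 then es ! i else 0)"
    by (intro sum_mono) auto
  also have "\<dots> = (\<Sum>i\<in>I. es ! i)"
    by (simp add: I_def sum.If_cases Int_def)
  also have "\<dots> = (\<Sum>i\<in>I. \<Sum>r<m. (\<Sum>c<f. B $$ (r, c) * x i c)\<^sup>2)"
    by (simp add: energy)
  also have "\<dots> \<le> k * real (card I) + (k * real (card {..<f}) - real (card ?N))"
    using entries cols by (intro sign_matrix_trace_bound I(1) finite_lessThan orth) auto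
  also have "\<dots> \<le> k * real s + (k * real f - real (card ?N))"
  \<comment> \<open>The trace bound counts only the indices in \<open>I\<close>; with
    \<open>k \<ge> 0\<close> it may be relaxed to all \<open>s\<close>.\<close>
  proof -
    have "card I \<le> card {..<s}" by (intro card_mono) (auto simp: I_def)
    then show ?thesis using k by (simp add: mult_left_mono)
  qed
  finally show ?thesis .
qed

section \<open>Application to the Laplacian of a simplicial tree\<close>

text \<open>Each of the \<open>k\<close> ridges of a facet contributes one entry of square 1. This
  provides the constant column norm required by the trace bound.\<close>

lemma sum_boundary_entry_sq:
  assumes "F \<subseteq> {1..n}" "card F = k"
  shows "(\<Sum>G\<in>{S. S \<subseteq> {1..n} \<and> card S = k - 1}. (boundary_entry G F)\<^sup>2) = real k"
proof -
  let ?R = "{S. S \<subseteq> {1..n} \<and> card S = k - 1}" and ?D = "(\<lambda>v. F - {v}) ` F"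
  have fin: "finite F" using assms(1) finite_subset by blast
  have "finite ?R" by (rule finite_subset[of _ "Pow {1..n}"]) auto
  moreover have "?D \<subseteq> ?R" using assms by auto
  ultimately have "(\<Sum>G\<in>?R. (boundary_entry G F)\<^sup>2) = real (card ?D)"
    by (simp add: boundary_entry_sq[OF fin] of_bool_def sum.If_cases Int_absorb1 Int_absorb2)
  then show ?thesis by (simp add: card_ridges_of_facet assms(2))
qed

theorem theorem26:
  fixes k n t :: nat and T :: "nat set set"
  assumes "k \<ge> 2"
    and "simplicial_tree k n T"
    and "t \<ge> 1"
  shows "(\<Sum>i=1..t. laplacian_eigenvalue k n T i)
           \<le> (real k - 1) * real (card T) + real k * real t - real k + 1"
proof -
  define rows where "rows = subset_list n (k - 1)"
  define cols where "cols = filter (\<lambda>F. F \<in> T) (subset_list n k)"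
  define B where "B = boundary_matrix k n T"
  let ?m = "length rows" and ?f = "length cols"
  have fam: "T \<noteq> {}" "\<And>F. F \<in> T \<Longrightarrow> F \<subseteq> {1..n} \<and> card F = k"
    using assms(2) by (auto simp: simplicial_tree_def k_family_def)
  have finF: "finite F" if "F \<in> T" for F
    using fam(2)[OF that] finite_subset by blast
  have "T \<subseteq> Pow {1..n}" using fam(2) by blast
  then have finT: "finite T" by (rule finite_subset) simp
  have sub_leaf: "\<forall>S. S \<noteq> {} \<and> S \<subseteq> T \<longrightarrow> (\<exists>F. leaf S F)"
  proof (intro allI impI)
    fix S assume "S \<noteq> {} \<and> S \<subseteq> T"
    then have "k_subfamily k n S T" using fam(2) by (auto simp: k_subfamily_def k_family_def)
    then show "\<exists>F. leaf S F" using assms(2) by (simp add: simplicial_tree_def)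
  qed
  have cols: "distinct cols" "set cols = T"
    using fam(2) by (auto simp: cols_def distinct_subset_list set_subset_list)
  have rows: "distinct rows" "set rows = {S. S \<subseteq> {1..n} \<and> card S = k - 1}"
    by (simp_all add: rows_def distinct_subset_list set_subset_list)
  have f: "?f = card T" using distinct_card[OF cols(1)] cols(2) by simp
  have B: "B \<in> carrier_mat ?m ?f"
    and entry: "\<And>r c. r < ?m \<Longrightarrow> c < ?f \<Longrightarrow> B $$ (r, c) = boundary_entry (rows ! r) (cols ! c)"
    by (auto simp: B_def boundary_matrix_def Let_def rows_def cols_def)
  have col_in: "cols ! c \<in> T" if "c < ?f" for c using cols(2) that nth_mem by blast
  have col_sum: "(\<Sum>r<?m. (B $$ (r, c))\<^sup>2) = real k" if c: "c < ?f" for c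
  proof -
    have "(\<Sum>r<?m. (B $$ (r, c))\<^sup>2) = (\<Sum>r<?m. (boundary_entry (rows ! r) (cols ! c))\<^sup>2)"
      using c by (simp add: entry)
    also have "\<dots> = (\<Sum>G\<in>set rows. (boundary_entry G (cols ! c))\<^sup>2)"
      by (rule sum.reindex_bij_betw[OF bij_betw_nth[OF rows(1) refl refl]])
    finally show ?thesis
      using fam(2)[OF col_in[OF c]] sum_boundary_entry_sq[of "cols ! c" n k] unfolding rows(2) by simp
  qed
  let ?N = "{r\<in>{..<?m}. \<exists>c\<in>{..<?f}. B $$ (r, c) \<noteq> 0}"
  \<comment> \<open>Each ridge labels a nonzero row of \<open>B\<close>, so the number of nonzero
    rows is at least the number of ridges.\<close>
  have "ridges T \<subseteq> (!) rows ` ?N"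
  proof
    fix G assume "G \<in> ridges T"
    then obtain F where F: "F \<in> T" "G \<in> (\<lambda>v. F - {v}) ` F" by (auto simp: ridges_def)
    then have "G \<in> set rows" using fam(2)[OF F(1)] by (auto simp: rows(2))
    then obtain r where r: "r < ?m" "G = rows ! r" by (auto simp: in_set_conv_nth)
    obtain c where c: "c < ?f" "F = cols ! c" using F(1) cols(2) by (metis in_set_conv_nth)
    have "B $$ (r, c) \<noteq> 0"
      using boundary_entry_nonzero_iff[OF finF[OF F(1)], of G] F(2) r c by (simp add: entry)
    with r c show "G \<in> (!) rows ` ?N" by blast
  qed
  then have "card (ridges T) \<le> card ?N" by (rule surj_card_le[rotated]) simp
  moreover have "card T + k - 1 \<le> card (ridges T)"
    using finT fam finF assms(1) sub_leaf by (intro card_ridges_ge) auto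
  ultimately have ridge_bound: "real (card T) + real k - 1 \<le> real (card ?N)"
    using assms(1) by linarith

  define ls where "ls = laplacian_spectrum k n T"
  \<comment> \<open>Eigenvalues past the end of the spectrum default to 0, so the sum may be cut at
    the length of the list.\<close>
  define s where "s = min t (length ls)"
  have "(\<Sum>i=1..t. laplacian_eigenvalue k n T i) = (\<Sum>i<t. if i < length ls then ls ! i else 0)"
    by (simp add: sum.atLeast1_atMost_eq laplacian_eigenvalue_def Suc_le_eq Let_def
        flip: ls_def cong: if_cong)
  also have "\<dots> = (\<Sum>i<s. ls ! i)"
    by (intro sum.mono_neutral_cong_right) (auto simp: s_def)
  also have "\<dots> \<le> real k * real s + (real k * real ?f - real (card ?N))"
  proof (rule sum_gram_eigenvalues_le[OF B])
    show "mset ls = proots (char_poly (B * transpose_mat B))"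
      by (simp add: ls_def laplacian_spectrum_def laplacian_def B_def)
  qed (use boundary_entry_range col_sum in \<open>simp_all add: entry s_def\<close>)
  \<comment> \<open>Uses \<open>s \<le> t\<close> and the lower bound f + k - 1 on the number of
    nonzero rows.\<close>
  also have "\<dots> \<le> real k * real t + (real k * real (card T) - real (card T) - real k + 1)"
    using ridge_bound f mult_left_mono[of "real s" "real t" "real k"] by (simp add: s_def)
  finally show ?thesis by (simp add: algebra_simps)
qed

end
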